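(* Let $Q$ be a finite alphabet of size $q \ge 2$, $Z$ a countable set, and $\pi_q = \mathrm{lcm}(1,2,\dots,q)$. For a network $f : Q^Z \to Q^Z$ and $s \subseteq Z$, let $f^{(s)}(x) = (f_s(x), x_{Z \setminus s})$ and $f^{(s_1,\dots,s_k)} = f^{(s_k)} \circ \dots \circ f^{(s_1)}$. Call $f$ locally commutative if $f^{(i,j)} = f^{(j,i)}$ for all $i,j \in Z$, and globally commutative if $f^{(s,t)} = f^{(t,s)}$ for all $s,t \subseteq Z$. Consider the properties: (B) $f$ is bijective; (Bi) $f^{(i)}$ is bijective for all $i \in Z$; (Bb) $f^{(b)}$ is bijective for all finite $b \subseteq Z$; (Bs) $f^{(s)}$ is bijective for all $s \subseteq Z$; (Ds) $f^{(s)}$ satisfies $(f^{(s)})^{\pi_q + q - 1} = (f^{(s)})^{q-1}$ for all $s \subseteq Z$. Then: (1) for globally commutative $f$, (B) $\iff$ (Bi) $\iff$ (Bb) $\iff$ (Bs); (2) for locally commutative $f$, (Bs) $\implies$ (B) $\implies$ (Bi) $\iff$ (Bb); (3) there exists a locally commutative network satisfying (B) and (Ds) but not (Bs); (4) there exists a locally commutative network satisfying (Bi) and (Ds) but not (B).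
   Context: Automata networks $f: Q^Z \to Q^Z$ with $Q$ finite and $Z$ countable; $x_s$ denotes the restriction of $x$ to $s$. *)

theory Defs
  imports "HOL-Library.FuncSet" "HOL-Library.Countable_Set"
begin

text \<open>
  The configuration space \<open>Q\<^sup>Z\<close> is the set \<open>Z \<rightarrow>\<^sub>E Q\<close> of extensional functions, so that its
  elements are determined by their values on \<open>Z\<close>. Maps on configurations are total HOL functions
  of which only the behaviour on \<open>Z \<rightarrow>\<^sub>E Q\<close> matters; equality of such maps is therefore always
  stated pointwise on \<open>Z \<rightarrow>\<^sub>E Q\<close>, and bijectivity by \<open>bij_betw\<close>.
\<close>

type_synonym ('z, 'q) config = "'z \<Rightarrow> 'q"

definition network :: "'q set \<Rightarrow> 'z set \<Rightarrow> (('z, 'q) config \<Rightarrow> ('z, 'q) config) \<Rightarrow> bool" where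
  "network Q Z f \<longleftrightarrow> f \<in> (Z \<rightarrow>\<^sub>E Q) \<rightarrow> (Z \<rightarrow>\<^sub>E Q)"

definition bijective_on_configs ::
    "'q set \<Rightarrow> 'z set \<Rightarrow> (('z, 'q) config \<Rightarrow> ('z, 'q) config) \<Rightarrow> bool" where
  "bijective_on_configs Q Z g \<longleftrightarrow> bij_betw g (Z \<rightarrow>\<^sub>E Q) (Z \<rightarrow>\<^sub>E Q)"

text \<open>\<open>override_on x (f x) s\<close> agrees with \<open>f x\<close> on \<open>s\<close> and with \<open>x\<close> elsewhere.\<close>

definition update ::
    "(('z, 'q) config \<Rightarrow> ('z, 'q) config) \<Rightarrow> 'z set \<Rightarrow> ('z, 'q) config \<Rightarrow> ('z, 'q) config" where
  "update f s x = override_on x (f x) s"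

text \<open>\<open>fold\<close> applies the head of the list first:
  \<open>updates f [s, t] = update f t \<circ> update f s\<close>.\<close>

definition updates ::
    "(('z, 'q) config \<Rightarrow> ('z, 'q) config) \<Rightarrow> 'z set list \<Rightarrow> ('z, 'q) config \<Rightarrow> ('z, 'q) config" where
  "updates f ss = fold (update f) ss"

definition locally_commutative ::
    "'q set \<Rightarrow> 'z set \<Rightarrow> (('z, 'q) config \<Rightarrow> ('z, 'q) config) \<Rightarrow> bool" where
  "locally_commutative Q Z f \<longleftrightarrow>
     (\<forall>i\<in>Z. \<forall>j\<in>Z. \<forall>x \<in> Z \<rightarrow>\<^sub>E Q. updates f [{i}, {j}] x = updates f [{j}, {i}] x)"

definition globally_commutative ::
    "'q set \<Rightarrow> 'z set \<Rightarrow> (('z, 'q) config \<Rightarrow> ('z, 'q) config) \<Rightarrow> bool" where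
  "globally_commutative Q Z f \<longleftrightarrow>
     (\<forall>s\<subseteq>Z. \<forall>t\<subseteq>Z. \<forall>x \<in> Z \<rightarrow>\<^sub>E Q. updates f [s, t] x = updates f [t, s] x)"

definition prop_B :: "'q set \<Rightarrow> 'z set \<Rightarrow> (('z, 'q) config \<Rightarrow> ('z, 'q) config) \<Rightarrow> bool" where
  "prop_B Q Z f \<longleftrightarrow> bijective_on_configs Q Z f"

definition prop_Bi :: "'q set \<Rightarrow> 'z set \<Rightarrow> (('z, 'q) config \<Rightarrow> ('z, 'q) config) \<Rightarrow> bool" where
  "prop_Bi Q Z f \<longleftrightarrow> (\<forall>i\<in>Z. bijective_on_configs Q Z (update f {i}))"

definition prop_Bb :: "'q set \<Rightarrow> 'z set \<Rightarrow> (('z, 'q) config \<Rightarrow> ('z, 'q) config) \<Rightarrow> bool" where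
  "prop_Bb Q Z f \<longleftrightarrow> (\<forall>b\<subseteq>Z. finite b \<longrightarrow> bijective_on_configs Q Z (update f b))"

definition prop_Bs :: "'q set \<Rightarrow> 'z set \<Rightarrow> (('z, 'q) config \<Rightarrow> ('z, 'q) config) \<Rightarrow> bool" where
  "prop_Bs Q Z f \<longleftrightarrow> (\<forall>s\<subseteq>Z. bijective_on_configs Q Z (update f s))"

definition lcm_upto :: "nat \<Rightarrow> nat" where
  "lcm_upto q = Lcm {1..q}"

definition prop_Ds :: "'q set \<Rightarrow> 'z set \<Rightarrow> (('z, 'q) config \<Rightarrow> ('z, 'q) config) \<Rightarrow> bool" where
  "prop_Ds Q Z f \<longleftrightarrow>
     (\<forall>s\<subseteq>Z. \<forall>x \<in> Z \<rightarrow>\<^sub>E Q.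
        (update f s ^^ (lcm_upto (card Q) + card Q - 1)) x = (update f s ^^ (card Q - 1)) x)"

end

theory Submission
  imports Defs "HOL-Combinatorics.Transposition"
begin

text \<open>
  Under commutativity, \<open>f x i\<close> is unaffected by updating \<open>x\<close> away from \<open>i\<close>. If two configurations
  differing only at \<open>i\<close> are identified by \<open>f\<^sup>(\<^sup>i\<^sup>)\<close>, they are therefore identified by \<open>f\<close>, so
  (B) implies (Bi). In the globally commutative case \<open>(f\<^sup>(\<^sup>s\<^sup>))\<^sup>k\<close> and \<open>(f\<^sup>(\<^sup>i\<^sup>))\<^sup>k\<close> agree at
  every \<open>i \<in> s\<close>; for \<open>k = q!\<close> the latter is the identity, hence every \<open>f\<^sup>(\<^sup>s\<^sup>)\<close> is bijective.

  Both counterexamples swap two letters in all coordinates exactly when the configuration lies in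
  a set \<open>A\<close> closed under finite modifications. Injectivity fails as soon as an update takes some
  configuration out of \<open>A\<close>, since configurations outside \<open>A\<close> are fixed. For (3), \<open>A\<close> consists of the
  configurations with one of these two letters as eventual value, so that updating everything
  preserves \<open>A\<close> but updating the even coordinates does not; for (4), \<open>A\<close> consists of those with
  one particular eventual value.
\<close>

section \<open>Commutative networks\<close>

lemma update_apply: "update f s x i = (if i \<in> s then f x i else x i)"
  by (simp add: update_def override_on_def)

lemma updates_pair: "updates f [s, t] x = update f t (update f s x)"
  by (simp add: updates_def)

lemma network_update:
  assumes "network Q Z f" "s \<subseteq> Z" "x \<in> Z \<rightarrow>\<^sub>E Q"
  shows "update f s x \<in> Z \<rightarrow>\<^sub>E Q"
proof -
  have "f x \<in> Z \<rightarrow>\<^sub>E Q" using assms by (auto simp: network_def)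
  then show ?thesis using assms(2,3) by (fastforce simp: update_apply PiE_iff extensional_def)
qed

lemma network_funpow_update:
  assumes "network Q Z f" "s \<subseteq> Z" "x \<in> Z \<rightarrow>\<^sub>E Q"
  shows "(update f s ^^ k) x \<in> Z \<rightarrow>\<^sub>E Q"
  using assms by (induction k) (simp_all add: network_update)

text \<open>Outside \<open>Z\<close> both \<open>x\<close> and \<open>f x\<close> are
  \<open>undefined\<close>, so keeping the old values there loses nothing.\<close>

lemma update_UNIV_configs:
  assumes "network Q Z f" "x \<in> Z \<rightarrow>\<^sub>E Q"
  shows "update f Z x = f x"
proof -
  have "f x \<in> Z \<rightarrow>\<^sub>E Q" using assms by (auto simp: network_def)
  then show ?thesis using assms(2) by (auto simp: fun_eq_iff update_apply PiE_iff extensional_def)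
qed

lemma prop_Bs_imp_B:
  assumes "network Q Z f" "prop_Bs Q Z f"
  shows "prop_B Q Z f"
proof -
  have "bij_betw (update f Z) (Z \<rightarrow>\<^sub>E Q) (Z \<rightarrow>\<^sub>E Q)"
    using assms(2) by (auto simp: prop_Bs_def bijective_on_configs_def)
  then show ?thesis
    unfolding prop_B_def bijective_on_configs_def
    using bij_betw_cong update_UNIV_configs[OF assms(1)] by metis
qed

section \<open>Local commutativity and finite sets of coordinates\<close>

lemma globally_imp_locally_commutative:
  "globally_commutative Q Z f \<Longrightarrow> locally_commutative Q Z f"
  by (simp add: globally_commutative_def locally_commutative_def)

text \<open>Read the two orders of updating at coordinate \<open>i\<close>: when \<open>j\<close>
  comes last, it leaves the value \<open>f x i\<close> alone.\<close>

lemma locally_commutativeD: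
  assumes "locally_commutative Q Z f" "i \<in> Z" "j \<in> Z" "i \<noteq> j" "x \<in> Z \<rightarrow>\<^sub>E Q"
  shows "f (update f {j} x) i = f x i"
proof -
  have "update f {j} (update f {i} x) i = update f {i} (update f {j} x) i"
    using assms by (simp add: locally_commutative_def updates_pair)
  then show ?thesis using assms(4) by (simp add: update_apply)
qed

lemma update_insert:
  assumes "i \<notin> b" "f (update f b x) i = f x i"
  shows "update f (insert i b) x = update f {i} (update f b x)"
  using assms by (auto simp: fun_eq_iff update_apply)

text \<open>Induction with \<open>i\<close> arbitrary: the hypothesis is used at the inserted
  \<open>j\<close>, to split off its update, and again at \<open>i\<close>.\<close>

lemma locally_commutative_finite:
  assumes "network Q Z f" "locally_commutative Q Z f" "finite b" "b \<subseteq> Z" "x \<in> Z \<rightarrow>\<^sub>E Q"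
    "i \<in> Z" "i \<notin> b"
  shows "f (update f b x) i = f x i"
  using assms(3,4,6,7)
proof (induction b arbitrary: i rule: finite_induct)
  case empty
  then show ?case by (simp add: update_def)
next
  case (insert j b)
  have "f (update f b x) j = f x j" using insert by auto
  then have "update f (insert j b) x = update f {j} (update f b x)"
    using insert.hyps by (simp add: update_insert)
  moreover have "f (update f {j} (update f b x)) i = f (update f b x) i"
    using insert.prems assms by (intro locally_commutativeD[OF assms(2)] network_update) auto
  ultimately show ?case using insert by auto
qed

lemma prop_Bi_imp_Bb:
  assumes "network Q Z f" "locally_commutative Q Z f" "prop_Bi Q Z f"
  shows "prop_Bb Q Z f"
proof -
  have "bij_betw (update f b) (Z \<rightarrow>\<^sub>E Q) (Z \<rightarrow>\<^sub>E Q)" if "finite b" "b \<subseteq> Z" for b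
    using that
  proof (induction b rule: finite_induct)
    case empty
    have "update f {} = id" by (simp add: fun_eq_iff update_apply)
    then show ?case using bij_betw_id by metis
  next
    case (insert i b)
    have "bij_betw (update f {i}) (Z \<rightarrow>\<^sub>E Q) (Z \<rightarrow>\<^sub>E Q)"
      using assms(3) insert.prems by (simp add: prop_Bi_def bijective_on_configs_def)
    moreover have "bij_betw (update f b) (Z \<rightarrow>\<^sub>E Q) (Z \<rightarrow>\<^sub>E Q)" using insert by auto
    ultimately have "bij_betw (update f {i} \<circ> update f b) (Z \<rightarrow>\<^sub>E Q) (Z \<rightarrow>\<^sub>E Q)"
      by (rule bij_betw_trans[rotated])
    moreover have "update f (insert i b) x = (update f {i} \<circ> update f b) x"
      if "x \<in> Z \<rightarrow>\<^sub>E Q" for x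
      using insert that by (simp add: update_insert locally_commutative_finite[OF assms(1,2)])
    ultimately show ?case
      using bij_betw_cong[of "Z \<rightarrow>\<^sub>E Q" "update f (insert i b)" "update f {i} \<circ> update f b"] by blast
  qed
  then show ?thesis by (simp add: prop_Bb_def bijective_on_configs_def)
qed

lemma prop_Bb_imp_Bi: "prop_Bb Q Z f \<Longrightarrow> prop_Bi Q Z f"
  by (simp add: prop_Bi_def prop_Bb_def)

section \<open>Updates of one coordinate and their finite fibres\<close>

lemma fun_upd_config: "x \<in> Z \<rightarrow>\<^sub>E Q \<Longrightarrow> i \<in> Z \<Longrightarrow> c \<in> Q \<Longrightarrow> x(i := c) \<in> Z \<rightarrow>\<^sub>E Q"
  by (auto simp: PiE_iff extensional_def)

text \<open>Fibres reduce a one-coordinate update on a possibly infinite space to self-maps of sets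
  with at most \<open>card Q\<close> points.\<close>

lemma update_single_fibre:
  assumes "network Q Z f" "i \<in> Z" "x \<in> Z \<rightarrow>\<^sub>E Q"
  shows "update f {i} ` (\<lambda>c. x(i := c)) ` Q \<subseteq> (\<lambda>c. x(i := c)) ` Q"
proof safe
  fix c assume "c \<in> Q"
  then have "f (x(i := c)) \<in> Z \<rightarrow>\<^sub>E Q"
    using assms fun_upd_config[of x Z Q i c] by (auto simp: network_def)
  then have "f (x(i := c)) i \<in> Q" using assms(2) by auto
  moreover have "update f {i} (x(i := c)) = x(i := f (x(i := c)) i)"
    by (simp add: fun_eq_iff update_apply)
  ultimately show "update f {i} (x(i := c)) \<in> (\<lambda>c. x(i := c)) ` Q" by auto
qed

lemma config_in_fibre:
  assumes "x \<in> Z \<rightarrow>\<^sub>E Q" "i \<in> Z"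
  shows "x \<in> (\<lambda>c. x(i := c)) ` Q"
proof
  show "x = x(i := x i)" by simp
  show "x i \<in> Q" using assms by auto
qed

text \<open>An injective self-map of a finite fibre is onto, and every configuration lies in its own
  fibre.\<close>

lemma inj_on_update_single_imp_bij:
  assumes "finite Q" "network Q Z f" "i \<in> Z" "inj_on (update f {i}) (Z \<rightarrow>\<^sub>E Q)"
  shows "bij_betw (update f {i}) (Z \<rightarrow>\<^sub>E Q) (Z \<rightarrow>\<^sub>E Q)"
  unfolding bij_betw_def
proof (intro conjI equalityI subsetI)
  show "inj_on (update f {i}) (Z \<rightarrow>\<^sub>E Q)" by fact
next
  fix x assume "x \<in> update f {i} ` (Z \<rightarrow>\<^sub>E Q)"
  then show "x \<in> Z \<rightarrow>\<^sub>E Q" using network_update[OF assms(2), of "{i}"] assms(3) by blast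
next
  fix x assume x: "x \<in> Z \<rightarrow>\<^sub>E Q"
  let ?S = "(\<lambda>c. x(i := c)) ` Q"
  have S: "?S \<subseteq> Z \<rightarrow>\<^sub>E Q" using fun_upd_config[OF x assms(3)] by blast
  have "update f {i} ` ?S = ?S"
    using assms(1) inj_on_subset[OF assms(4) S] update_single_fibre[OF assms(2,3) x]
    by (intro endo_inj_surj) auto
  then have "x \<in> update f {i} ` ?S" using config_in_fibre[OF x assms(3)] by simp
  then show "x \<in> update f {i} ` (Z \<rightarrow>\<^sub>E Q)" using S by blast
qed

lemma prop_B_imp_Bi:
  assumes "finite Q" "network Q Z f" "locally_commutative Q Z f" "prop_B Q Z f"
  shows "prop_Bi Q Z f"
proof -
  have "bij_betw (update f {i}) (Z \<rightarrow>\<^sub>E Q) (Z \<rightarrow>\<^sub>E Q)" if i: "i \<in> Z" for i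
  proof (rule inj_on_update_single_imp_bij[OF assms(1,2) i], rule inj_onI)
    fix x y
    assume x: "x \<in> Z \<rightarrow>\<^sub>E Q" and y: "y \<in> Z \<rightarrow>\<^sub>E Q" and eq: "update f {i} x = update f {i} y"
    \<comment> \<open>For \<open>j\<close> in \<open>Z\<close> other than \<open>i\<close>, both
      sides equal the value of \<open>f\<close> at \<open>j\<close> on the common update. At
      \<open>i\<close> that update itself gives the equality, and outside \<open>Z\<close> both are
      \<open>undefined\<close>.\<close>
    have "f x j = f y j" for j
    proof (cases "j \<in> Z \<and> j \<noteq> i")
      case True
      then show ?thesis
        using locally_commutativeD[OF assms(3) _ i, of j] x y eq by metis
    next
      case False
      have "f x \<in> Z \<rightarrow>\<^sub>E Q" "f y \<in> Z \<rightarrow>\<^sub>E Q" using assms(2) x y by (auto simp: network_def)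
      moreover have "f x i = f y i" using fun_cong[OF eq, of i] by (simp add: update_apply)
      ultimately show ?thesis using False by (auto simp: PiE_iff extensional_def)
    qed
    then have "f x = f y" by (rule ext)
    moreover have "inj_on f (Z \<rightarrow>\<^sub>E Q)"
      using assms(4) by (simp add: prop_B_def bijective_on_configs_def bij_betw_def)
    ultimately show "x = y" using x y by (metis inj_onD)
  qed
  then show ?thesis by (simp add: prop_Bi_def bijective_on_configs_def)
qed

text \<open>By pigeonhole two of the iterates with exponents \<open>0..q\<close> coincide.
  Cancelling the common part by injectivity leaves a period \<open>d\<close> with
  \<open>0 < d\<close> and \<open>d \<le> q\<close>, which divides \<open>fact q\<close>.\<close>

lemma funpow_fact_id:
  assumes "finite S" "card S \<le> q" "g ` S \<subseteq> S" "inj_on g S" "a \<in> S"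
  shows "(g ^^ fact q) a = a"
proof -
  have in_S: "(g ^^ k) a \<in> S" for k using assms(3,5) by (induction k) auto
  have "\<not> inj_on (\<lambda>k. (g ^^ k) a) {..q}"
  proof
    assume "inj_on (\<lambda>k. (g ^^ k) a) {..q}"
    then have "card {..q} \<le> card S" using in_S assms(1) by (intro card_inj_on_le) auto
    then show False using assms(2) by simp
  qed
  then obtain m n where mn: "m < n" "n \<le> q" "(g ^^ m) a = (g ^^ n) a"
    by (auto simp: inj_on_def) (metis linorder_neqE_nat)
  have cancel: "(g ^^ k) a = (g ^^ (k + d)) a \<Longrightarrow> a = (g ^^ d) a" for k d
  proof (induction k)
    case (Suc k)
    then show ?case using in_S assms(4) by (auto simp: inj_on_def)
  qed simp
  define d where "d = n - m"
  have d: "0 < d" "d \<le> q" "(g ^^ d) a = a"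
    using mn cancel[of m "n - m"] by (auto simp: d_def)
  then have "d dvd fact q" by (intro dvd_fact) auto
  then obtain e where "fact q = d * e" by (auto elim: dvdE)
  moreover have "(g ^^ (d * e)) a = a"
    by (induction e) (auto simp: funpow_add d(3))
  ultimately show ?thesis by simp
qed

text \<open>The exponent depends on neither \<open>i\<close> nor \<open>x\<close>, so it serves all
  coordinates at once.\<close>

lemma update_single_fact:
  assumes "finite Q" "network Q Z f" "prop_Bi Q Z f" "i \<in> Z" "x \<in> Z \<rightarrow>\<^sub>E Q"
  shows "(update f {i} ^^ fact (card Q)) x = x"
proof (rule funpow_fact_id)
  let ?S = "(\<lambda>c. x(i := c)) ` Q"
  show "finite ?S" "card ?S \<le> card Q" using assms(1) by (auto intro: card_image_le)
  show "update f {i} ` ?S \<subseteq> ?S" by (rule update_single_fibre[OF assms(2,4,5)])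
  have "inj_on (update f {i}) (Z \<rightarrow>\<^sub>E Q)"
    using assms(3,4) by (auto simp: prop_Bi_def bijective_on_configs_def bij_betw_def)
  then show "inj_on (update f {i}) ?S"
    by (rule inj_on_subset) (use fun_upd_config[OF assms(5,4)] in blast)
  show "x \<in> ?S" by (rule config_in_fibre[OF assms(5,4)])
qed

section \<open>Global commutativity and iterates of infinite updates\<close>

lemma globally_commutativeD:
  assumes "globally_commutative Q Z f" "s \<subseteq> Z" "t \<subseteq> Z" "x \<in> Z \<rightarrow>\<^sub>E Q"
  shows "update f t (update f s x) = update f s (update f t x)"
  using assms by (simp add: globally_commutative_def updates_pair)

text \<open>Commuting \<open>{i}\<close> with \<open>s - {i}\<close> and reading at \<open>i\<close>
  shows that updating the rest of \<open>s\<close>, even if infinite, does not affect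
  \<open>f\<close> at \<open>i\<close>.\<close>

lemma globally_commutative_update_split:
  assumes "globally_commutative Q Z f" "s \<subseteq> Z" "i \<in> s" "x \<in> Z \<rightarrow>\<^sub>E Q"
  shows "update f s x = update f {i} (update f (s - {i}) x)"
proof -
  have "update f {i} (update f (s - {i}) x) = update f (s - {i}) (update f {i} x)"
    using assms by (intro globally_commutativeD) auto
  from fun_cong[OF this, of i] have "f (update f (s - {i}) x) i = f x i"
    by (simp add: update_apply)
  then have "update f (insert i (s - {i})) x = update f {i} (update f (s - {i}) x)"
    by (intro update_insert) auto
  then show ?thesis using assms(3) by (simp add: insert_absorb)
qed

lemma globally_commutative_funpow_apply:
  assumes "network Q Z f" "globally_commutative Q Z f" "s \<subseteq> Z" "i \<in> s" "x \<in> Z \<rightarrow>\<^sub>E Q"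
  shows "(update f s ^^ k) x i = (update f {i} ^^ k) x i"
proof -
  let ?t = "s - {i}"
  have t: "?t \<subseteq> Z" and i: "{i} \<subseteq> Z" using assms by auto
  note mem = network_funpow_update[OF assms(1) t] network_funpow_update[OF assms(1) i]
  have comm: "update f {i} ((update f ?t ^^ k) y) = (update f ?t ^^ k) (update f {i} y)"
    if "y \<in> Z \<rightarrow>\<^sub>E Q" for y k
  proof (induction k)
    case (Suc k)
    then show ?case using globally_commutativeD[OF assms(2) t i] mem(1) that by simp
  qed simp
  \<comment> \<open>A power of a product of commuting maps splits into powers; the outer factor
    never touches \<open>i\<close>.\<close>
  have "(update f s ^^ k) x = (update f ?t ^^ k) ((update f {i} ^^ k) x)"
  proof (induction k)
    case (Suc k)
    let ?y = "(update f {i} ^^ k) x"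
    have y: "?y \<in> Z \<rightarrow>\<^sub>E Q" by (rule mem(2)[OF assms(5)])
    have "(update f s ^^ Suc k) x = update f s ((update f ?t ^^ k) ?y)" using Suc by simp
    also have "\<dots> = update f {i} ((update f ?t ^^ Suc k) ?y)"
      using globally_commutative_update_split[OF assms(2-4)] mem(1)[OF y] by simp
    also have "\<dots> = (update f ?t ^^ Suc k) (update f {i} ?y)" by (rule comm[OF y])
    finally show ?case by simp
  qed simp
  moreover have "(update f ?t ^^ k) y i = y i" for y k
    by (induction k) (auto simp: update_apply)
  ultimately show ?thesis by simp
qed

lemma funpow_update_outside: "i \<notin> s \<Longrightarrow> (update f s ^^ k) x i = x i"
  by (induction k) (auto simp: update_apply)

lemma prop_Bi_imp_Bs:
  assumes "finite Q" "network Q Z f" "globally_commutative Q Z f" "prop_Bi Q Z f"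
  shows "prop_Bs Q Z f"
proof -
  have "bij_betw (update f s) (Z \<rightarrow>\<^sub>E Q) (Z \<rightarrow>\<^sub>E Q)" if s: "s \<subseteq> Z" for s
  proof -
    have id: "(update f s ^^ fact (card Q)) x = x" if x: "x \<in> Z \<rightarrow>\<^sub>E Q" for x
    proof
      fix i
      show "(update f s ^^ fact (card Q)) x i = x i"
      proof (cases "i \<in> s")
        case True
        then show ?thesis
          using globally_commutative_funpow_apply[OF assms(2,3) s _ x, of i]
            update_single_fact[OF assms(1,2,4) _ x, of i] s by auto
      qed (rule funpow_update_outside)
    qed
    \<comment> \<open>The power \<open>fact (card Q)\<close> is the identity, so the power one lower
      is the inverse.\<close>
    obtain m where m: "fact (card Q) = Suc m" using fact_gt_zero[of "card Q"] gr0_implies_Suc by blast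
    show ?thesis
    proof (rule bij_betw_byWitness[where f' = "update f s ^^ m"])
      show "\<forall>x\<in>Z \<rightarrow>\<^sub>E Q. (update f s ^^ m) (update f s x) = x"
        using id by (simp add: m funpow_swap1)
      show "\<forall>x\<in>Z \<rightarrow>\<^sub>E Q. update f s ((update f s ^^ m) x) = x"
        using id by (simp add: m)
      show "update f s ` (Z \<rightarrow>\<^sub>E Q) \<subseteq> Z \<rightarrow>\<^sub>E Q" using network_update[OF assms(2) s] by auto
      show "(update f s ^^ m) ` (Z \<rightarrow>\<^sub>E Q) \<subseteq> Z \<rightarrow>\<^sub>E Q"
        using network_funpow_update[OF assms(2) s] by auto
    qed
  qed
  then show ?thesis by (simp add: prop_Bs_def bijective_on_configs_def)
qed

section \<open>Counterexamples\<close>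

definition swap_on :: "'q \<Rightarrow> 'q \<Rightarrow> ('z \<Rightarrow> 'q) set \<Rightarrow> ('z \<Rightarrow> 'q) \<Rightarrow> 'z \<Rightarrow> 'q" where
  "swap_on a b A x = (if x \<in> A then transpose a b \<circ> x else x)"

text \<open>Single changes suffice: iterating them makes \<open>A\<close> a union of classes of
  equality up to finitely many coordinates.\<close>

definition finite_change_closed :: "('z \<Rightarrow> 'q) set \<Rightarrow> bool" where
  "finite_change_closed A \<longleftrightarrow> (\<forall>x i c. x(i := c) \<in> A \<longleftrightarrow> x \<in> A)"

lemma update_single: "update f {i} x = x(i := f x i)"
  by (simp add: fun_eq_iff update_apply)

lemma fun_upd_mem_iff: "finite_change_closed A \<Longrightarrow> x(i := c) \<in> A \<longleftrightarrow> x \<in> A"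
  by (simp add: finite_change_closed_def)

lemma transpose_closed: "a \<in> Q \<Longrightarrow> b \<in> Q \<Longrightarrow> c \<in> Q \<Longrightarrow> transpose a b c \<in> Q"
  by (simp add: transpose_def)

lemma network_swap_on:
  assumes "a \<in> Q" "b \<in> Q"
  shows "network Q UNIV (swap_on a b A)"
  using assms by (auto simp: network_def swap_on_def PiE_iff transpose_closed)

text \<open>A one-coordinate update preserves membership in \<open>A\<close>, so both updates apply
  the same fixed permutation of letters, each at its own coordinate.\<close>

lemma locally_commutative_swap_on:
  assumes "finite_change_closed A"
  shows "locally_commutative Q UNIV (swap_on a b A)"
  using assms
  by (auto simp: locally_commutative_def updates_pair update_single swap_on_def fun_upd_mem_iff
      intro: fun_upd_twist)

text \<open>As membership in \<open>A\<close> survives, the update at \<open>i\<close> is an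
  involution.\<close>

lemma prop_Bi_swap_on:
  assumes "finite_change_closed A" "a \<in> Q" "b \<in> Q"
  shows "prop_Bi Q UNIV (swap_on a b A)"
proof -
  have "bij_betw (update (swap_on a b A) {i}) (UNIV \<rightarrow>\<^sub>E Q) (UNIV \<rightarrow>\<^sub>E Q)" for i
  proof -
    let ?g = "update (swap_on a b A) {i}"
    have "?g (?g x) = x" for x
      using assms(1)
      by (simp add: update_single swap_on_def fun_upd_mem_iff)
    moreover have "?g ` (UNIV \<rightarrow>\<^sub>E Q) \<subseteq> UNIV \<rightarrow>\<^sub>E Q"
      by (intro image_subsetI network_update[OF network_swap_on[OF assms(2,3)]]) simp_all
    ultimately show ?thesis by (intro bij_betw_byWitness[where f' = ?g]) auto
  qed
  then show ?thesis by (simp add: prop_Bi_def bijective_on_configs_def)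
qed

lemma update_swap_on:
  "update (swap_on a b A) s x = (if x \<in> A then override_on x (transpose a b \<circ> x) s else x)"
  by (auto simp: fun_eq_iff update_apply swap_on_def override_on_def)

text \<open>After one update the configuration is either outside \<open>A\<close>, and is fixed from then on, or
  in \<open>A\<close>, and returns at the next update.\<close>

lemma update_swap_on_cube:
  fixes a b A s
  defines "g \<equiv> update (swap_on a b A) s"
  shows "g (g (g x)) = g x"
proof -
  let ?h = "\<lambda>x. override_on x (transpose a b \<circ> x) s"
  have "?h (?h x) = x" by (auto simp: fun_eq_iff override_on_def)
  then show ?thesis by (simp add: g_def update_swap_on)
qed

text \<open>On its image \<open>g\<close> is an involution, so after at least one application an
  even number of further ones changes nothing.\<close>

lemma funpow_mult_eq_of_cube:
  assumes "\<And>x. g (g (g x)) = g x" "0 < n" "even p"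
  shows "(g ^^ (p + n)) x = (g ^^ n) x"
proof -
  obtain m where m: "n = Suc m" using assms(2) gr0_implies_Suc by blast
  obtain k where k: "p = 2 * k" using assms(3) by (auto elim: evenE)
  have "(g ^^ (2 * k)) (g y) = g y" for y
    by (induction k) (auto simp: assms(1))
  then have "(g ^^ (2 * k)) (g ((g ^^ m) x)) = g ((g ^^ m) x)" .
  then show ?thesis by (simp only: m k funpow_add o_apply funpow.simps(2))
qed

text \<open>As \<open>card Q\<close> is at least 2, the number 2 divides the lcm and the exponent
  \<open>card Q - 1\<close> is positive.\<close>

lemma prop_Ds_swap_on:
  assumes "card Q \<ge> 2"
  shows "prop_Ds Q Z (swap_on a b A)"
proof -
  have "even (lcm_upto (card Q))" using assms by (auto simp: lcm_upto_def intro: dvd_Lcm)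
  then show ?thesis
    using assms funpow_mult_eq_of_cube[where g = "update (swap_on a b A) s" for s,
        OF update_swap_on_cube, of "card Q - 1" "lcm_upto (card Q)"]
    by (simp add: prop_Ds_def)
qed

section \<open>Eventual values and the two networks\<close>

definition eventually_in :: "'q set \<Rightarrow> (nat \<Rightarrow> 'q) set" where
  "eventually_in C = {x. \<exists>c\<in>C. eventually (\<lambda>n. x n = c) sequentially}"

lemma finite_change_closed_eventually_in: "finite_change_closed (eventually_in C)"
proof -
  \<comment> \<open>A change at \<open>i\<close> is invisible beyond \<open>i\<close>.\<close>
  have "eventually (\<lambda>n. (x(i := c)) n = d) sequentially \<longleftrightarrow> eventually (\<lambda>n. x n = d) sequentially"
    for x :: "nat \<Rightarrow> 'a" and i c d
    by (rule eventually_subst[OF eventually_mono[OF eventually_gt_at_top[of i]]]) simp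
  then show ?thesis by (simp add: finite_change_closed_def eventually_in_def)
qed

lemma exists_B_not_Bs:
  fixes Q :: "'q set"
  assumes "card Q \<ge> 2" and ab: "a \<in> Q" "b \<in> Q" "a \<noteq> b"
  defines "f \<equiv> swap_on a b (eventually_in {a, b})"
  shows "network Q UNIV f" "locally_commutative Q UNIV f" "prop_B Q UNIV f"
    "prop_Ds Q UNIV f" "\<not> prop_Bs Q UNIV f"
proof -
  show net: "network Q UNIV f" unfolding f_def by (rule network_swap_on[OF ab(1,2)])
  show "locally_commutative Q UNIV f"
    unfolding f_def by (rule locally_commutative_swap_on[OF finite_change_closed_eventually_in])
  show "prop_Ds Q UNIV f" unfolding f_def by (rule prop_Ds_swap_on[OF assms(1)])
  \<comment> \<open>The swap exchanges the eventual values \<open>a\<close> and \<open>b\<close>, so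
    it preserves the set and \<open>f\<close> is an involution.\<close>
  have "transpose a b \<circ> x \<in> eventually_in {a, b}" if "x \<in> eventually_in {a, b}" for x
  proof -
    obtain c where c: "c \<in> {a, b}" "eventually (\<lambda>n. x n = c) sequentially"
      using \<open>x \<in> eventually_in {a, b}\<close> by (auto simp: eventually_in_def)
    have "eventually (\<lambda>n. (transpose a b \<circ> x) n = transpose a b c) sequentially"
      using c(2) by (rule eventually_mono) simp
    moreover have "transpose a b c \<in> {a, b}" using c(1) by auto
    ultimately show ?thesis unfolding eventually_in_def by blast
  qed
  then have "f (f x) = x" for x by (auto simp: f_def swap_on_def fun_eq_iff)
  moreover have "f ` (UNIV \<rightarrow>\<^sub>E Q) \<subseteq> UNIV \<rightarrow>\<^sub>E Q" using net by (auto simp: network_def)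
  ultimately show "prop_B Q UNIV f"
    unfolding prop_B_def bijective_on_configs_def
    by (intro bij_betw_byWitness[where f' = f]) auto
  show "\<not> prop_Bs Q UNIV f"
  proof
    assume "prop_Bs Q UNIV f"
    then have inj: "inj_on (update f {n. even n}) (UNIV \<rightarrow>\<^sub>E Q)"
      by (auto simp: prop_Bs_def bijective_on_configs_def bij_betw_def)
    \<comment> \<open>Updating the even coordinates sends the constant \<open>x\<close> to the
      alternating \<open>y\<close>, which has no eventual value and hence is fixed: \<open>x\<close>
      and \<open>y\<close> collide.\<close>
    define x y :: "nat \<Rightarrow> 'q" where "x = (\<lambda>n. a)" and "y = (\<lambda>n. if even n then b else a)"
    have "x \<in> eventually_in {a, b}" by (simp add: x_def eventually_in_def)
    then have "update f {n. even n} x = y"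
      by (auto simp: f_def update_swap_on x_def y_def override_on_def fun_eq_iff)
    moreover have "y \<notin> eventually_in {a, b}"
    proof
      assume "y \<in> eventually_in {a, b}"
      then obtain c N where N: "\<And>n. n \<ge> N \<Longrightarrow> y n = c"
        by (auto simp: eventually_in_def eventually_sequentially)
      show False using N[of "2 * N"] N[of "2 * N + 1"] ab(3) by (simp add: y_def)
    qed
    then have "update f {n. even n} y = y" by (simp add: f_def update_swap_on)
    moreover have "x \<in> UNIV \<rightarrow>\<^sub>E Q" "y \<in> UNIV \<rightarrow>\<^sub>E Q" using ab by (auto simp: x_def y_def)
    ultimately have "x = y" using inj by (metis inj_onD)
    then have "x 0 = y 0" by simp
    then show False using ab(3) by (simp add: x_def y_def)
  qed
qed

lemma exists_Bi_not_B:
  fixes Q :: "'q set"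
  assumes "card Q \<ge> 2" and ab: "a \<in> Q" "b \<in> Q" "a \<noteq> b"
  defines "f \<equiv> swap_on a b (eventually_in {a})"
  shows "network Q UNIV f" "locally_commutative Q UNIV f" "prop_Bi Q UNIV f"
    "prop_Ds Q UNIV f" "\<not> prop_B Q UNIV f"
proof -
  note closed = finite_change_closed_eventually_in
  show "network Q UNIV f" unfolding f_def by (rule network_swap_on[OF ab(1,2)])
  show "locally_commutative Q UNIV f" unfolding f_def by (rule locally_commutative_swap_on[OF closed])
  show "prop_Ds Q UNIV f" unfolding f_def by (rule prop_Ds_swap_on[OF assms(1)])
  show "prop_Bi Q UNIV f" unfolding f_def by (rule prop_Bi_swap_on[OF closed ab(1,2)])
  show "\<not> prop_B Q UNIV f"
  proof
    assume "prop_B Q UNIV f"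
    then have inj: "inj_on f (UNIV \<rightarrow>\<^sub>E Q)"
      by (auto simp: prop_B_def bijective_on_configs_def bij_betw_def)
    \<comment> \<open>The constant \<open>b\<close> is fixed, its eventual value not being
      \<open>a\<close>, yet it is also the image of the constant \<open>a\<close>.\<close>
    have "f (\<lambda>n. a) = (\<lambda>n. b)" "f (\<lambda>n. b) = (\<lambda>n. b)"
      using ab(3) by (auto simp: f_def swap_on_def eventually_in_def fun_eq_iff)
    moreover have "(\<lambda>n. a) \<in> UNIV \<rightarrow>\<^sub>E Q" "(\<lambda>n. b) \<in> UNIV \<rightarrow>\<^sub>E Q" using ab by auto
    ultimately have "(\<lambda>n::nat. a) = (\<lambda>n. b)" using inj by (metis inj_onD)
    then show False using ab(3) by (simp add: fun_eq_iff)
  qed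
qed

theorem theorem4:
  fixes Q :: "'q set" and Z :: "'z set"
  assumes "finite Q" and "card Q \<ge> 2" and "countable Z"
  shows
    "(\<forall>f. network Q Z f \<and> globally_commutative Q Z f \<longrightarrow>
        (prop_B Q Z f \<longleftrightarrow> prop_Bi Q Z f) \<and>
        (prop_Bi Q Z f \<longleftrightarrow> prop_Bb Q Z f) \<and>
        (prop_Bb Q Z f \<longleftrightarrow> prop_Bs Q Z f)) \<and>
     (\<forall>f. network Q Z f \<and> locally_commutative Q Z f \<longrightarrow>
        (prop_Bs Q Z f \<longrightarrow> prop_B Q Z f) \<and>
        (prop_B Q Z f \<longrightarrow> prop_Bi Q Z f) \<and>
        (prop_Bi Q Z f \<longleftrightarrow> prop_Bb Q Z f)) \<and>
     (\<exists>(Y :: nat set) f. countable Y \<and> network Q Y f \<and> locally_commutative Q Y f \<and>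
        prop_B Q Y f \<and> prop_Ds Q Y f \<and> \<not> prop_Bs Q Y f) \<and>
     (\<exists>(Y :: nat set) f. countable Y \<and> network Q Y f \<and> locally_commutative Q Y f \<and>
        prop_Bi Q Y f \<and> prop_Ds Q Y f \<and> \<not> prop_B Q Y f)"
proof (intro conjI)
  show "\<forall>f. network Q Z f \<and> globally_commutative Q Z f \<longrightarrow>
        (prop_B Q Z f \<longleftrightarrow> prop_Bi Q Z f) \<and>
        (prop_Bi Q Z f \<longleftrightarrow> prop_Bb Q Z f) \<and>
        (prop_Bb Q Z f \<longleftrightarrow> prop_Bs Q Z f)"
    using prop_Bs_imp_B prop_B_imp_Bi[OF assms(1)] prop_Bi_imp_Bs[OF assms(1)] prop_Bi_imp_Bb
      prop_Bb_imp_Bi globally_imp_locally_commutative by metis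
  show "\<forall>f. network Q Z f \<and> locally_commutative Q Z f \<longrightarrow>
        (prop_Bs Q Z f \<longrightarrow> prop_B Q Z f) \<and>
        (prop_B Q Z f \<longrightarrow> prop_Bi Q Z f) \<and>
        (prop_Bi Q Z f \<longleftrightarrow> prop_Bb Q Z f)"
    using prop_Bs_imp_B prop_B_imp_Bi[OF assms(1)] prop_Bi_imp_Bb prop_Bb_imp_Bi by metis
  obtain a b where ab: "a \<in> Q" "b \<in> Q" "a \<noteq> b"
    using assms(1,2) card_le_Suc0_iff_eq[of Q] by fastforce
  show "\<exists>(Y :: nat set) f. countable Y \<and> network Q Y f \<and> locally_commutative Q Y f \<and>
        prop_B Q Y f \<and> prop_Ds Q Y f \<and> \<not> prop_Bs Q Y f"
    using exists_B_not_Bs[OF assms(2) ab] countableI_type by blast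
  show "\<exists>(Y :: nat set) f. countable Y \<and> network Q Y f \<and> locally_commutative Q Y f \<and>
        prop_Bi Q Y f \<and> prop_Ds Q Y f \<and> \<not> prop_B Q Y f"
    using exists_Bi_not_B[OF assms(2) ab] countableI_type by blast
qed

end
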